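(* Let $H\in\mathbb{R}^{n\times n}$ be self-adjoint, $h\in\mathbb{R}^n$, $f(x)=\tfrac12\langle Hx,x\rangle+\langle h,x\rangle$, and let $g:\mathbb{R}^n\to\mathbb{R}\cup\{\infty\}$ be proper, closed and convex. Let $L=\lambda_{\max}(H)$, $\gamma\in(0,\tfrac1L)$, and suppose that $m=\lambda_{\min}(H)\ge0$. Then the forward-backward envelope $F_\gamma^{\mathrm{FB}}$ (defined in the context) is $\gamma^{-1}(1-\gamma m)$-smooth and $\min\big((1-\gamma m)m,(1-\gamma L)L\big)$-strongly convex, both with respect to the induced norm $\|\cdot\|$.
   Context: $\langle\cdot,\cdot\rangle$ is an inner product on $\mathbb{R}^n$ with induced norm $\|\cdot\|$. A differentiable $\phi:\mathbb{R}^n\to\mathbb{R}$ is $\beta$-smooth ($\beta\ge0$) if $-\tfrac\beta2\|x-y\|^2\le\phi(x)-\phi(y)-\langle\nabla\phi(y),x-y\rangle\le\tfrac\beta2\|x-y\|^2$ for all $x,y$. $\phi$ is $\sigma$-strongly convex if $\phi-\tfrac\sigma2\|\cdot\|^2$ is convex (for $\sigma=0$ this means $\phi$ is convex). The conjugate of $\phi$ is $\phi^*(y)=\sup_x\{\langle y,x\rangle-\phi(x)\}$. For $\gamma>0$ put $r_{\gamma g}(x)=\gamma g(x)+\tfrac12\|x\|^2$; its conjugate $r_{\gamma g}^*$ is differentiable with $\nabla r_{\gamma g}^*=\mathrm{prox}_{\gamma g}$, where $\mathrm{prox}_{\gamma g}(z)=\operatorname{argmin}_x\{g(x)+\tfrac1{2\gamma}\|x-z\|^2\}$.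 The forward-backward envelope is $$F_\gamma^{\mathrm{FB}}(x)=\gamma^{-1}\Big(\langle x-\gamma\nabla f(x),x\rangle-\big(\tfrac12\|x\|^2-\gamma f(x)\big)-r_{\gamma g}^*\big(x-\gamma\nabla f(x)\big)\Big).$$ If $L=0$, the interval $(0,1/L)$ is read as $(0,\infty)$. *)

theory Defs
  imports "HOL-Analysis.Analysis"
begin

section \<open>Smoothness and strong convexity\<close>

definition gradient :: "('a::real_inner \<Rightarrow> real) \<Rightarrow> 'a \<Rightarrow> 'a" where
  "gradient \<phi> x = (THE D. GDERIV \<phi> x :> D)"

definition smooth_fun :: "real \<Rightarrow> ('a::real_inner \<Rightarrow> real) \<Rightarrow> bool" where
  "smooth_fun \<beta> \<phi> \<longleftrightarrow>
     \<beta> \<ge> 0 \<and> (\<forall>x. \<phi> differentiable (at x)) \<and>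
     (\<forall>x y. - (\<beta> / 2) * (norm (x - y))\<^sup>2 \<le> \<phi> x - \<phi> y - gradient \<phi> y \<bullet> (x - y) \<and>
            \<phi> x - \<phi> y - gradient \<phi> y \<bullet> (x - y) \<le> (\<beta> / 2) * (norm (x - y))\<^sup>2)"

definition strongly_convex :: "real \<Rightarrow> ('a::real_inner \<Rightarrow> real) \<Rightarrow> bool" where
  "strongly_convex \<sigma> \<phi> \<longleftrightarrow> convex_on UNIV (\<lambda>x. \<phi> x - (\<sigma> / 2) * (norm x)\<^sup>2)"

section \<open>Extended-real-valued functions\<close>

text \<open>The library's \<^const>\<open>epigraph\<close> only covers real-valued functions. The height \<open>t\<close> of a
  point of the epigraph is a real number also when the function takes infinite values.\<close>

definition ereal_epigraph :: "('a \<Rightarrow> ereal) \<Rightarrow> ('a \<times> real) set" where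
  "ereal_epigraph g = {(x, t). g x \<le> ereal t}"

definition proper_fun :: "('a \<Rightarrow> ereal) \<Rightarrow> bool" where
  "proper_fun g \<longleftrightarrow> (\<forall>x. g x \<noteq> -\<infinity>) \<and> (\<exists>x. g x \<noteq> \<infinity>)"

definition closed_fun :: "('a::topological_space \<Rightarrow> ereal) \<Rightarrow> bool" where
  "closed_fun g \<longleftrightarrow> closed (ereal_epigraph g)"

definition convex_fun :: "('a::real_vector \<Rightarrow> ereal) \<Rightarrow> bool" where
  "convex_fun g \<longleftrightarrow> convex (ereal_epigraph g)"

definition conjugate_fun :: "('a::real_inner \<Rightarrow> ereal) \<Rightarrow> 'a \<Rightarrow> ereal" where
  "conjugate_fun \<phi> y = (SUP x. ereal (y \<bullet> x) - \<phi> x)"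

section \<open>The forward-backward envelope\<close>

text \<open>\<open>reg_fun \<gamma> g\<close> is $r_{\gamma g}$. The envelope is defined with values in \<^typ>\<open>ereal\<close>, because
  the conjugate is a supremum in the extended reals; that it is finite for proper, closed,
  convex \<open>g\<close> is something to be proved.\<close>

definition reg_fun :: "real \<Rightarrow> ('a::real_inner \<Rightarrow> ereal) \<Rightarrow> 'a \<Rightarrow> ereal" where
  "reg_fun \<gamma> g x = ereal \<gamma> * g x + ereal (1 / 2 * (norm x)\<^sup>2)"

definition forward_backward_envelope ::
    "real \<Rightarrow> ('a::real_inner \<Rightarrow> real) \<Rightarrow> ('a \<Rightarrow> ereal) \<Rightarrow> 'a \<Rightarrow> ereal" where
  "forward_backward_envelope \<gamma> f g x =
     ereal (inverse \<gamma>) *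
       (ereal ((x - \<gamma> *\<^sub>R gradient f x) \<bullet> x - (1 / 2 * (norm x)\<^sup>2 - \<gamma> * f x))
        - conjugate_fun (reg_fun \<gamma> g) (x - \<gamma> *\<^sub>R gradient f x))"

section \<open>Eigenvalues\<close>

text \<open>Real eigenvalues of a linear operator. A self-adjoint operator on a Euclidean space has
  finitely many, and at least one, so that \<^const>\<open>Max\<close> and \<^const>\<open>Min\<close> below are meaningful.\<close>

definition eigenvalues :: "('a::real_vector \<Rightarrow> 'a) \<Rightarrow> real set" where
  "eigenvalues H = {c. \<exists>v. v \<noteq> 0 \<and> H v = c *\<^sub>R v}"

definition lambda_max :: "('a::real_vector \<Rightarrow> 'a) \<Rightarrow> real" where
  "lambda_max H = Max (eigenvalues H)"

definition lambda_min :: "('a::real_vector \<Rightarrow> 'a) \<Rightarrow> real" where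
  "lambda_min H = Min (eigenvalues H)"

end

theory Submission
  imports Defs
begin

text \<open>Since \<open>f\<close> is quadratic, \<open>\<gamma> F(x) = <P x, x> / 2 - r*(P x - \<gamma> h)\<close> with \<open>P = I - \<gamma> H\<close>.
  The function \<open>r*\<close> is convex and \<open>1\<close>-smooth, because the supremum defining it is attained and
  \<open>r\<close> is \<open>1\<close>-strongly convex; hence its linearisation error over the step \<open>P d\<close> lies in
  \<open>[0, |P d|^2 / 2]\<close>. So the linearisation error of \<open>F\<close> over \<open>d\<close> is at most
  \<open><P d, d> / (2 \<gamma>)\<close> and at least \<open>(<P d, d> - |P d|^2) / (2 \<gamma>) = <(1 - \<gamma> H) H d, d> / 2\<close>.
  Both are controlled by the extreme eigenvalues of \<open>H\<close>, as \<open>\<lambda> \<mapsto> (1 - \<gamma> \<lambda>) \<lambda>\<close> is concave.\<close>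

section \<open>Functions with quadratic bounds on the linearisation error\<close>

lemma gradient_eqI:
  assumes "GDERIV \<phi> x :> D"
  shows "gradient \<phi> x = D"
  unfolding gradient_def
proof (rule the_equality)
  fix E assume "GDERIV \<phi> x :> E"
  then have "(\<lambda>h. h \<bullet> E) = (\<lambda>h. h \<bullet> D)"
    using assms has_derivative_unique unfolding gderiv_def by blast
  then have "(E - D) \<bullet> (E - D) = 0"
    by (metis inner_diff_right right_minus_eq)
  then show "E = D" by simp
qed (fact assms)

text \<open>A quadratic error makes the difference quotient of the remainder at most
  \<open>c * norm (x - y)\<close>, which tends to 0. The gradient can thus be read off from the
  inequalities alone.\<close>

lemma GDERIV_quadratic_bound:
  fixes \<phi> :: "'a::real_inner \<Rightarrow> real"
  assumes "\<And>x. \<bar>\<phi> x - \<phi> y - D \<bullet> (x - y)\<bar> \<le> c * (norm (x - y))\<^sup>2"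
  shows "GDERIV \<phi> y :> D"
  unfolding gderiv_def
proof (rule has_derivativeI_sandwich[where e = 1 and H = "\<lambda>x. c * norm (x - y)"])
  show "bounded_linear (\<lambda>h. h \<bullet> D)" by (rule bounded_linear_inner_left)
  fix x assume "x \<noteq> y"
  then show "norm (\<phi> x - \<phi> y - (x - y) \<bullet> D) / norm (x - y) \<le> c * norm (x - y)"
    using assms[of x] by (simp add: divide_simps power2_eq_square inner_commute)
next
  show "((\<lambda>x. c * norm (x - y)) \<longlongrightarrow> 0) (at y)"
    by (rule tendsto_eq_intros refl | simp)+
qed simp

lemma smooth_funI:
  assumes "\<beta> \<ge> 0"
    and bound: "\<And>x y. \<bar>\<phi> x - \<phi> y - G y \<bullet> (x - y)\<bar> \<le> \<beta> / 2 * (norm (x - y))\<^sup>2"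
  shows "smooth_fun \<beta> \<phi>"
proof -
  have der: "GDERIV \<phi> y :> G y" for y
    by (rule GDERIV_quadratic_bound[OF bound])
  then have "\<phi> differentiable (at y)" for y
    unfolding gderiv_def differentiable_def by blast
  moreover have "gradient \<phi> y = G y" for y
    by (rule gradient_eqI[OF der])
  ultimately show ?thesis
    using assms unfolding smooth_fun_def abs_le_iff by (auto simp: minus_le_iff)
qed

text \<open>Removing the quadratic turns the bound into a supporting affine function at every point.
  Convexity follows by averaging the two support inequalities taken at the convex combination
  \<open>z\<close>.\<close>

lemma strongly_convexI:
  fixes \<phi> :: "'a::real_inner \<Rightarrow> real"
  assumes bound: "\<And>x y. \<sigma> / 2 * (norm (x - y))\<^sup>2 \<le> \<phi> x - \<phi> y - G y \<bullet> (x - y)"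
  shows "strongly_convex \<sigma> \<phi>"
  unfolding strongly_convex_def
proof (rule convex_onI)
  let ?c = "\<lambda>x. \<phi> x - \<sigma> / 2 * (norm x)\<^sup>2"
  fix t :: real and x y :: 'a
  assume t: "0 < t" "t < 1"
  define z where "z = (1 - t) *\<^sub>R x + t *\<^sub>R y"
  \<comment> \<open>The slope \<open>G z\<close> is corrected by the gradient of the subtracted
    quadratic at \<open>z\<close>.\<close>
  define D where "D = G z - \<sigma> *\<^sub>R z"
  have tangent: "?c w \<ge> ?c z + D \<bullet> (w - z)" for w
    using bound[of w z] unfolding D_def
    by (simp add: power2_norm_eq_inner inner_diff_left inner_diff_right inner_commute
        algebra_simps)
  have "?c z = (1 - t) * (?c z + D \<bullet> (x - z)) + t * (?c z + D \<bullet> (y - z))"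
  proof -
    have "(1 - t) *\<^sub>R (x - z) + t *\<^sub>R (y - z) = 0"
      unfolding z_def by (simp add: algebra_simps)
    then have "(1 - t) * (D \<bullet> (x - z)) + t * (D \<bullet> (y - z)) = 0"
      by (metis inner_add_right inner_scaleR_right inner_zero_right)
    moreover have "C = (1 - t) * (C + p) + t * (C + q)" if "(1 - t) * p + t * q = 0" for C p q
      using that by (simp add: algebra_simps)
    ultimately show ?thesis by blast
  qed
  also have "\<dots> \<le> (1 - t) * ?c x + t * ?c y"
    using t by (intro add_mono mult_left_mono tangent) auto
  finally show "?c ((1 - t) *\<^sub>R x + t *\<^sub>R y) \<le> (1 - t) * ?c x + t * ?c y"
    by (simp only: z_def)
qed simp

section \<open>The conjugate of a regularised convex function\<close>

text \<open>A hyperplane strictly separates the epigraph from a point one unit below it; solved for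
  the height, it is an affine minorant.\<close>

lemma closed_convex_affine_minorant:
  fixes g :: "'a::euclidean_space \<Rightarrow> ereal"
  assumes "proper_fun g" "closed_fun g" "convex_fun g"
  obtains a b where "\<And>x t. g x \<le> ereal t \<Longrightarrow> a \<bullet> x + b \<le> t"
proof -
  obtain x0 s where s: "g x0 = ereal s"
    using assms(1) unfolding proper_fun_def by (metis ereal_cases)
  have "(x0, s - 1) \<notin> ereal_epigraph g"
    unfolding ereal_epigraph_def by (simp add: s)
  then obtain d c where dc: "d \<bullet> (x0, s - 1) < c" "\<And>z. z \<in> ereal_epigraph g \<Longrightarrow> c < d \<bullet> z"
    using separating_hyperplane_closed_point[of "ereal_epigraph g" "(x0, s - 1)"] assms
    unfolding closed_fun_def convex_fun_def by metis
  obtain a \<alpha> where d: "d = (a, \<alpha>)" by (cases d)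
  have sep: "c < a \<bullet> x + \<alpha> * t" if "g x \<le> ereal t" for x t
    using dc(2)[of "(x, t)"] that unfolding ereal_epigraph_def d by simp
  \<comment> \<open>The hyperplane passes between the heights \<open>s - 1\<close> and
    \<open>s\<close> over the same point \<open>x0\<close>, so it is not vertical.\<close>
  have "\<alpha> > 0"
    using dc(1) sep[of x0 s] s unfolding d by (simp add: algebra_simps)
  show ?thesis
  proof (rule that[of "- (inverse \<alpha> *\<^sub>R a)" "c / \<alpha>"])
    fix x t assume "g x \<le> ereal t"
    from sep[OF this] show "- (inverse \<alpha> *\<^sub>R a) \<bullet> x + c / \<alpha> \<le> t"
      using \<open>\<alpha> > 0\<close> by (simp add: field_simps)
  qed
qed

text \<open>Minimising over pairs (point, height) in the epigraph makes the objective real and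
  continuous, with closedness of the epigraph in the role of lower semicontinuity. Sublevel sets are
  compact because the quadratic dominates the affine minorant.\<close>

lemma regularised_minimizer:
  fixes g :: "'a::euclidean_space \<Rightarrow> ereal"
  assumes "proper_fun g" "closed_fun g" "convex_fun g" "\<gamma> > 0"
  obtains p s where "g p \<le> ereal s"
    "\<And>x t. g x \<le> ereal t \<Longrightarrow>
      \<gamma> * s + (norm p)\<^sup>2 / 2 - v \<bullet> p \<le> \<gamma> * t + (norm x)\<^sup>2 / 2 - v \<bullet> x"
proof -
  obtain a b where ab: "\<And>x t. g x \<le> ereal t \<Longrightarrow> a \<bullet> x + b \<le> t"
    using closed_convex_affine_minorant assms by metis
  obtain x0 s0 where s0: "g x0 = ereal s0"
    using assms(1) unfolding proper_fun_def by (metis ereal_cases)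
  define \<Phi> where "\<Phi> = (\<lambda>z. \<gamma> * snd z + (norm (fst z))\<^sup>2 / 2 - v \<bullet> fst z)"
  define c where "c = \<Phi> (x0, s0)"
  have cont: "continuous_on S \<Phi>" for S
    unfolding \<Phi>_def by (intro continuous_intros) simp
  define K where "K = ereal_epigraph g \<inter> {z. \<Phi> z \<le> c}"
  have "closed K"
    using assms(2) cont unfolding K_def closed_fun_def
    by (intro closed_Int closed_Collect_le continuous_on_const) auto
  have "(x0, s0) \<in> K"
    unfolding K_def ereal_epigraph_def c_def using s0 by simp
  then have "K \<noteq> {}" by blast
  \<comment> \<open>Replacing \<open>t\<close> by its affine minorant leaves the linear term
    \<open>w\<close>. The radius \<open>r\<close> is the larger root of
    \<open>r^2 / 2 - norm w * r = \<bar>c - \<gamma> * b\<bar>\<close>.\<close>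
  define w where "w = \<gamma> *\<^sub>R a - v"
  define r where "r = norm w + sqrt ((norm w)\<^sup>2 + 2 * \<bar>c - \<gamma> * b\<bar>)"
  have "norm x \<le> r \<and> t \<in> {- (norm a * r) + b..(c + norm v * r) / \<gamma>}" if "(x, t) \<in> K" for x t
  proof -
    have g: "g x \<le> ereal t" and le: "\<gamma> * t + (norm x)\<^sup>2 / 2 - v \<bullet> x \<le> c"
      using that unfolding K_def ereal_epigraph_def \<Phi>_def by auto
    have "\<gamma> * (a \<bullet> x + b) \<le> \<gamma> * t"
      using ab[OF g] \<open>\<gamma> > 0\<close> by simp
    then have "(norm x)\<^sup>2 / 2 + w \<bullet> x \<le> c - \<gamma> * b"
      using le unfolding w_def by (simp add: inner_diff_left algebra_simps)
    moreover have "- (norm w * norm x) \<le> w \<bullet> x"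
      using Cauchy_Schwarz_ineq2[of w x] by linarith
    ultimately have "(norm x)\<^sup>2 / 2 - norm w * norm x \<le> \<bar>c - \<gamma> * b\<bar>"
      by linarith
    then have "(norm x - norm w)\<^sup>2 \<le> (norm w)\<^sup>2 + 2 * \<bar>c - \<gamma> * b\<bar>"
      by (simp add: power2_diff mult.commute)
    then have x: "norm x \<le> r"
      unfolding r_def using real_le_rsqrt by fastforce
    have ax: "\<bar>a \<bullet> x\<bar> \<le> norm a * r" and vx: "\<bar>v \<bullet> x\<bar> \<le> norm v * r"
      using Cauchy_Schwarz_ineq2[of a x] Cauchy_Schwarz_ineq2[of v x] x
      by (meson mult_left_mono norm_ge_zero order_trans)+
    have "\<gamma> * t \<le> c + norm v * r"
      using le vx by (smt (verit) zero_le_power2 divide_nonneg_pos)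
    then show ?thesis
      using x ax ab[OF g] \<open>\<gamma> > 0\<close> by (auto simp: pos_le_divide_eq mult.commute)
  qed
  then have "K \<subseteq> cball 0 r \<times> {- (norm a * r) + b..(c + norm v * r) / \<gamma>}"
    by auto
  then have "bounded K"
    by (rule bounded_subset[rotated]) (intro bounded_Times bounded_cball bounded_closed_interval)
  with \<open>closed K\<close> have "compact K" by (simp add: compact_eq_bounded_closed)
  then obtain z where z: "z \<in> K" "\<And>y. y \<in> K \<Longrightarrow> \<Phi> z \<le> \<Phi> y"
    using continuous_attains_inf[OF _ \<open>K \<noteq> {}\<close> cont] by metis
  \<comment> \<open>Outside \<open>K\<close> the objective exceeds \<open>c\<close>, hence also its
    value at \<open>z\<close>.\<close>
  have min: "\<Phi> z \<le> \<Phi> y" if "y \<in> ereal_epigraph g" for y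
    using that z unfolding K_def by (cases "\<Phi> y \<le> c") fastforce+
  show ?thesis
  proof (rule that[of "fst z" "snd z"])
    show "g (fst z) \<le> ereal (snd z)"
      using z(1) unfolding K_def ereal_epigraph_def by auto
    show "\<gamma> * snd z + (norm (fst z))\<^sup>2 / 2 - v \<bullet> fst z \<le> \<gamma> * t + (norm x)\<^sup>2 / 2 - v \<bullet> x"
      if "g x \<le> ereal t" for x t
      using min[of "(x, t)"] that unfolding \<Phi>_def ereal_epigraph_def by simp
  qed
qed

text \<open>The objective is 1-strongly convex. The minimiser is compared with the point a fraction
  \<open>e\<close> of the way to \<open>x\<close>; dividing by \<open>e\<close> and letting
  \<open>e\<close> tend to 0 leaves the full quadratic gain.\<close>

lemma regularised_minimizer_growth:
  fixes g :: "'a::real_inner \<Rightarrow> ereal"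
  assumes "convex_fun g" "g p \<le> ereal s"
    and min: "\<And>x t. g x \<le> ereal t \<Longrightarrow>
      \<gamma> * s + (norm p)\<^sup>2 / 2 - v \<bullet> p \<le> \<gamma> * t + (norm x)\<^sup>2 / 2 - v \<bullet> x"
    and "g x \<le> ereal t"
  shows "\<gamma> * s + (norm p)\<^sup>2 / 2 - v \<bullet> p + (norm (x - p))\<^sup>2 / 2
      \<le> \<gamma> * t + (norm x)\<^sup>2 / 2 - v \<bullet> x"
proof -
  define A where "A = \<gamma> * s + (norm p)\<^sup>2 / 2 - v \<bullet> p"
  define B where "B = \<gamma> * t + (norm x)\<^sup>2 / 2 - v \<bullet> x"
  define q where "q = (norm (x - p))\<^sup>2 / 2"
  have "A + (1 - e) * q \<le> B" if e: "0 < e" "e < 1" for e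
  proof -
    have "(1 - e) *\<^sub>R (p, s) + e *\<^sub>R (x, t) \<in> ereal_epigraph g"
      using assms e unfolding convex_fun_def
      by (intro convexD) (auto simp: ereal_epigraph_def)
    then have "g ((1 - e) *\<^sub>R p + e *\<^sub>R x) \<le> ereal ((1 - e) * s + e * t)"
      by (simp add: ereal_epigraph_def)
    from min[OF this] have "A \<le> (1 - e) * A + e * B - e * ((1 - e) * q)"
      unfolding A_def B_def q_def power2_norm_eq_inner
      by (simp add: inner_add_left inner_add_right inner_diff_left inner_diff_right
          inner_commute field_simps)
    then have "e * (A + (1 - e) * q) \<le> e * B"
      by (simp add: algebra_simps)
    then show ?thesis using e by simp
  qed
  then have "\<forall>\<^sub>F e in at_right 0. A + (1 - e) * q \<le> B"
    by (intro eventually_at_rightI[of 0 1]) auto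
  moreover have "((\<lambda>e. A + (1 - e) * q) \<longlongrightarrow> A + (1 - 0) * q) (at_right 0)"
    by (intro tendsto_intros)
  ultimately have "A + (1 - 0) * q \<le> B"
    using tendsto_upperbound trivial_limit_at_right_real by blast
  then show ?thesis unfolding A_def B_def q_def by simp
qed

text \<open>\<open>P v\<close> is the proximal point of \<open>v\<close>, and \<open>R v\<close> is
  minus the minimal value of the regularised problem. Using \<open>P v\<close> as a competitor in
  the problem for \<open>u\<close> gives the lower bound; quadratic growth in the problem for
  \<open>v\<close> at \<open>P u\<close> gives the upper one.\<close>

lemma conjugate_reg_fun_smooth:
  fixes g :: "'a::euclidean_space \<Rightarrow> ereal"
  assumes "proper_fun g" "closed_fun g" "convex_fun g" "\<gamma> > 0"
  obtains R :: "'a \<Rightarrow> real" and P :: "'a \<Rightarrow> 'a"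
  where "\<And>v. conjugate_fun (reg_fun \<gamma> g) v = ereal (R v)"
    "\<And>u v. 0 \<le> R u - R v - P v \<bullet> (u - v)"
    "\<And>u v. R u - R v - P v \<bullet> (u - v) \<le> (norm (u - v))\<^sup>2 / 2"
proof -
  have "\<forall>v. \<exists>p s. g p \<le> ereal s \<and> (\<forall>x t. g x \<le> ereal t \<longrightarrow>
      \<gamma> * s + (norm p)\<^sup>2 / 2 - v \<bullet> p \<le> \<gamma> * t + (norm x)\<^sup>2 / 2 - v \<bullet> x)"
    using regularised_minimizer[OF assms] by metis
  then obtain P s where P: "\<And>v. g (P v) \<le> ereal (s v)"
    and min: "\<And>v x t. g x \<le> ereal t \<Longrightarrow>
      \<gamma> * s v + (norm (P v))\<^sup>2 / 2 - v \<bullet> P v \<le> \<gamma> * t + (norm x)\<^sup>2 / 2 - v \<bullet> x"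
    by metis
  define R where "R v = v \<bullet> P v - \<gamma> * s v - (norm (P v))\<^sup>2 / 2" for v
  have growth: "v \<bullet> x - \<gamma> * t - (norm x)\<^sup>2 / 2 \<le> R v - (norm (x - P v))\<^sup>2 / 2"
    if "g x \<le> ereal t" for v x t
    using regularised_minimizer_growth[OF assms(3) P min that, of v] unfolding R_def by simp
  have "conjugate_fun (reg_fun \<gamma> g) v = ereal (R v)" for v
    unfolding conjugate_fun_def
  proof (rule antisym[OF SUP_least])
    fix x
    show "ereal (v \<bullet> x) - reg_fun \<gamma> g x \<le> ereal (R v)"
    proof (cases "g x")
      case (real t)
      have "v \<bullet> x - \<gamma> * t - (norm x)\<^sup>2 / 2 \<le> R v - (norm (x - P v))\<^sup>2 / 2"
        by (rule growth) (simp add: real)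
      also have "\<dots> \<le> R v" by simp
      finally show ?thesis by (simp add: reg_fun_def real)
    next
      case PInf
      then show ?thesis using \<open>\<gamma> > 0\<close> by (simp add: reg_fun_def)
    next
      case MInf
      then show ?thesis using assms(1) by (simp add: proper_fun_def)
    qed
  next
    have "g (P v) \<noteq> -\<infinity>" using assms(1) by (simp add: proper_fun_def)
    \<comment> \<open>The height \<open>s v\<close> is only known to bound \<open>g (P v)\<close>
      from above, so the exact value \<open>t\<close> is extracted.\<close>
    then obtain t where t: "g (P v) = ereal t" "t \<le> s v"
      using P[of v] by (cases "g (P v)") auto
    have "\<gamma> * t \<le> \<gamma> * s v" using t(2) \<open>\<gamma> > 0\<close> by simp
    then have "ereal (R v) \<le> ereal (v \<bullet> P v) - reg_fun \<gamma> g (P v)"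
      by (simp add: reg_fun_def t(1) R_def)
    also have "\<dots> \<le> (SUP x. ereal (v \<bullet> x) - reg_fun \<gamma> g x)"
      by (rule SUP_upper) simp
    finally show "ereal (R v) \<le> (SUP x. ereal (v \<bullet> x) - reg_fun \<gamma> g x)" .
  qed
  moreover have "0 \<le> R u - R v - P v \<bullet> (u - v)" for u v
    using min[OF P, of u v] unfolding R_def by (simp add: inner_diff_right inner_commute)
  moreover have "R u - R v - P v \<bullet> (u - v) \<le> (norm (u - v))\<^sup>2 / 2" for u v
  proof -
    \<comment> \<open>Growth bounds the error by \<open>(u - v) \<bullet> d - (norm d)^2 / 2\<close>
      with \<open>d = P u - P v\<close>; this square absorbs it.\<close>
    have "0 \<le> (norm ((u - v) - (P u - P v)))\<^sup>2" by simp
    then show ?thesis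
      using growth[OF P, of v u] unfolding R_def power2_norm_eq_inner
      by (simp add: inner_diff_left inner_diff_right inner_commute algebra_simps)
        (simp add: field_simps)
  qed
  ultimately show ?thesis by (rule that)
qed

section \<open>Quadratic bounds from the extreme eigenvalues\<close>

text \<open>Evaluate the form of \<open>A\<close> at \<open>c x - A x\<close>.\<close>

lemma psd_norm_le:
  fixes A :: "'a::real_inner \<Rightarrow> 'a"
  assumes "linear A" and sym: "\<And>x y. A x \<bullet> y = x \<bullet> A y"
    and psd: "\<And>x. 0 \<le> A x \<bullet> x" and le: "\<And>x. A x \<bullet> x \<le> c * (norm x)\<^sup>2" and "c > 0"
  shows "(norm (A x))\<^sup>2 \<le> c * (A x \<bullet> x)"
proof -
  have "0 \<le> A (c *\<^sub>R x - A x) \<bullet> (c *\<^sub>R x - A x)" by (rule psd)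
  also have "\<dots> = c * (c * (A x \<bullet> x)) - 2 * c * (norm (A x))\<^sup>2 + A (A x) \<bullet> A x"
    using sym[of "A x" x]
    by (simp add: linear_diff[OF assms(1)] linear_scale[OF assms(1)] inner_diff_left
        inner_diff_right power2_norm_eq_inner algebra_simps)
  also have "\<dots> \<le> c * (c * (A x \<bullet> x)) - c * (norm (A x))\<^sup>2"
    using le[of "A x"] by simp
  finally have "c * (norm (A x))\<^sup>2 \<le> c * (c * (A x \<bullet> x))" by simp
  then show ?thesis using \<open>c > 0\<close> by simp
qed

text \<open>Any operator norm bound \<open>c\<close> also bounds the quadratic form, so
  \<open>psd_norm_le\<close> controls \<open>(norm (A x))^2\<close> by \<open>c\<close> times a
  vanishing form.\<close>

lemma psd_kernel:
  fixes A :: "'a::euclidean_space \<Rightarrow> 'a"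
  assumes "linear A" "\<And>x y. A x \<bullet> y = x \<bullet> A y" "\<And>x. 0 \<le> A x \<bullet> x" "A x \<bullet> x = 0"
  shows "A x = 0"
proof -
  obtain c where "c > 0" and c: "\<And>x. norm (A x) \<le> c * norm x"
    using linear_bounded_pos[OF assms(1)] by blast
  have "A y \<bullet> y \<le> c * (norm y)\<^sup>2" for y
  proof -
    have "A y \<bullet> y \<le> norm (A y) * norm y" by (rule norm_cauchy_schwarz)
    also have "\<dots> \<le> c * norm y * norm y" by (intro mult_right_mono c) simp
    finally show ?thesis by (simp add: power2_eq_square mult.assoc)
  qed
  from psd_norm_le[OF assms(1-3) this \<open>c > 0\<close>, of x] show ?thesis
    using assms(4) by simp
qed

text \<open>The maximum \<open>c\<close> of the Rayleigh quotient is attained on the unit sphere.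
  Then \<open>c - H\<close> is positive semidefinite and its form vanishes at the maximiser, which
  is therefore an eigenvector.\<close>

lemma self_adjoint_max_eigenvalue:
  fixes H :: "'a::euclidean_space \<Rightarrow> 'a"
  assumes "linear H" and sym: "\<And>x y. H x \<bullet> y = x \<bullet> H y"
  obtains c where "c \<in> eigenvalues H" "\<And>x. H x \<bullet> x \<le> c * (norm x)\<^sup>2"
proof -
  have "continuous_on (sphere 0 1) (\<lambda>x. H x \<bullet> x)"
    using assms(1) by (intro continuous_on_inner linear_continuous_on continuous_on_id)
      (simp add: linear_conv_bounded_linear)
  from continuous_attains_sup[OF compact_sphere _ this]
  obtain v where v: "v \<in> sphere 0 1"
    and max: "\<And>x. x \<in> sphere 0 1 \<Longrightarrow> H x \<bullet> x \<le> H v \<bullet> v"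
    by auto
  define c where "c = H v \<bullet> v"
  have le: "H x \<bullet> x \<le> c * (norm x)\<^sup>2" for x
  proof (cases "x = 0")
    case False
    have "H (x /\<^sub>R norm x) \<bullet> (x /\<^sub>R norm x) \<le> c"
      unfolding c_def using False by (intro max) simp
    then show ?thesis using False
      by (simp add: linear_scale[OF assms(1)] divide_simps power2_eq_square)
  qed simp
  have "c *\<^sub>R v - H v = 0"
  proof (rule psd_kernel[where A = "\<lambda>x. c *\<^sub>R x - H x"])
    show "linear (\<lambda>x. c *\<^sub>R x - H x)"
      using assms(1) by (intro linear_compose_sub linear_compose_scale_right linear_id[unfolded id_def])
    show "(c *\<^sub>R x - H x) \<bullet> y = x \<bullet> (c *\<^sub>R y - H y)" for x y
      by (simp add: inner_diff_left inner_diff_right sym)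
    show "0 \<le> (c *\<^sub>R x - H x) \<bullet> x" for x
      using le[of x] by (simp add: inner_diff_left power2_norm_eq_inner)
    show "(c *\<^sub>R v - H v) \<bullet> v = 0"
      using v by (simp add: inner_diff_left c_def flip: power2_norm_eq_inner)
  qed
  then have "c \<in> eigenvalues H"
    using v unfolding eigenvalues_def by (auto intro!: exI[of _ v])
  then show ?thesis using le by (rule that)
qed

text \<open>Eigenvectors of distinct eigenvalues are orthogonal, hence independent, hence finite in
  number. Finiteness lets \<open>Max\<close> and \<open>Min\<close> bound the members of the
  set.\<close>

lemma finite_eigenvalues:
  fixes H :: "'a::euclidean_space \<Rightarrow> 'a"
  assumes sym: "\<And>x y. H x \<bullet> y = x \<bullet> H y"
  shows "finite (eigenvalues H)"
proof -
  have "\<forall>c\<in>eigenvalues H. \<exists>v. v \<noteq> 0 \<and> H v = c *\<^sub>R v"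
    by (simp add: eigenvalues_def)
  then obtain e where e: "\<And>c. c \<in> eigenvalues H \<Longrightarrow> e c \<noteq> 0 \<and> H (e c) = c *\<^sub>R e c"
    by metis
  have inj: "inj_on e (eigenvalues H)"
  proof (rule inj_onI)
    fix c d assume cd: "c \<in> eigenvalues H" "d \<in> eigenvalues H" "e c = e d"
    then have "c *\<^sub>R e d = d *\<^sub>R e d" using e by metis
    then show "c = d" using e[OF cd(2)] by simp
  qed
  have "pairwise orthogonal (e ` eigenvalues H)"
    unfolding pairwise_image
  proof (rule pairwiseI)
    fix c d assume "c \<in> eigenvalues H" "d \<in> eigenvalues H" "c \<noteq> d"
    then have "c * (e c \<bullet> e d) = d * (e c \<bullet> e d)"
      using sym[of "e c" "e d"] e[of c] e[of d] by simp
    then show "e c \<noteq> e d \<longrightarrow> orthogonal (e c) (e d)"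
      using \<open>c \<noteq> d\<close> by (simp add: orthogonal_def)
  qed
  moreover have "0 \<notin> e ` eigenvalues H" using e by force
  ultimately have "finite (e ` eigenvalues H)"
    using pairwise_orthogonal_independent independent_bound by blast
  then show ?thesis using inj by (rule finite_imageD)
qed

lemma self_adjoint_le_lambda_max:
  fixes H :: "'a::euclidean_space \<Rightarrow> 'a"
  assumes "linear H" "\<And>x y. H x \<bullet> y = x \<bullet> H y"
  shows "H x \<bullet> x \<le> lambda_max H * (norm x)\<^sup>2"
proof -
  obtain c where "c \<in> eigenvalues H" and c: "H x \<bullet> x \<le> c * (norm x)\<^sup>2"
    using self_adjoint_max_eigenvalue[OF assms] by metis
  then have "c \<le> lambda_max H"
    unfolding lambda_max_def by (intro Max_ge finite_eigenvalues assms(2))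
  then show ?thesis
    using c by (meson mult_right_mono order_trans zero_le_power2)
qed

text \<open>The Rayleigh argument is applied to \<open>- H\<close>, whose eigenvalues are the
  negatives of those of \<open>H\<close>.\<close>

lemma self_adjoint_ge_lambda_min:
  fixes H :: "'a::euclidean_space \<Rightarrow> 'a"
  assumes "linear H" "\<And>x y. H x \<bullet> y = x \<bullet> H y"
  shows "lambda_min H * (norm x)\<^sup>2 \<le> H x \<bullet> x"
proof -
  have "linear (\<lambda>x. - H x)" using assms(1) by (rule linear_compose_neg)
  then obtain c where c: "c \<in> eigenvalues (\<lambda>x. - H x)" "(- H x) \<bullet> x \<le> c * (norm x)\<^sup>2"
    using self_adjoint_max_eigenvalue[of "\<lambda>x. - H x"] assms(2)
    by (metis inner_minus_left inner_minus_right)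
  obtain v where "v \<noteq> 0" "- H v = c *\<^sub>R v"
    using c(1) unfolding eigenvalues_def by blast
  then have "v \<noteq> 0 \<and> H v = (- c) *\<^sub>R v"
    by (metis minus_minus scaleR_minus_left)
  then have "- c \<in> eigenvalues H"
    unfolding eigenvalues_def by blast
  then have "lambda_min H \<le> - c"
    unfolding lambda_min_def by (intro Min_le finite_eigenvalues assms(2))
  then have "lambda_min H * (norm x)\<^sup>2 \<le> - c * (norm x)\<^sup>2"
    by (rule mult_right_mono) simp
  then show ?thesis using c(2) by simp
qed

text \<open>The operator inequality \<open>(L - H) (H - m) \<ge> 0\<close>.\<close>

lemma self_adjoint_norm_le:
  fixes H :: "'a::euclidean_space \<Rightarrow> 'a"
  assumes "linear H" and sym: "\<And>x y. H x \<bullet> y = x \<bullet> H y"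
    and ge: "\<And>x. m * (norm x)\<^sup>2 \<le> H x \<bullet> x" and le: "\<And>x. H x \<bullet> x \<le> L * (norm x)\<^sup>2"
  shows "(norm (H x))\<^sup>2 \<le> (L + m) * (H x \<bullet> x) - L * m * (norm x)\<^sup>2"
proof -
  define A where "A = (\<lambda>x. H x - m *\<^sub>R x)"
  have A: "linear A" "A x \<bullet> y = x \<bullet> A y" "0 \<le> A x \<bullet> x" "A x \<bullet> x \<le> (L - m) * (norm x)\<^sup>2" for x y
    using assms(1) ge[of x] le[of x] unfolding A_def
    by (auto intro!: linear_compose_sub linear_compose_scale_right linear_id[unfolded id_def]
        simp: inner_diff_left inner_diff_right sym power2_norm_eq_inner algebra_simps)
  have "(norm (A x))\<^sup>2 \<le> (L - m) * (A x \<bullet> x)"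
  proof (cases "L - m > 0")
    case True
    then show ?thesis by (rule psd_norm_le[OF A])
  next
    case False
    \<comment> \<open>In this degenerate case the form of \<open>A\<close> is squeezed to 0, and so
      \<open>A x = 0\<close>.\<close>
    then have "(L - m) * (norm x)\<^sup>2 \<le> 0" by (simp add: mult_le_0_iff)
    then have "A x \<bullet> x = 0" using A(3,4)[of x] by simp
    moreover from this have "A x = 0" by (rule psd_kernel[OF A(1-3)])
    ultimately show ?thesis by simp
  qed
  then show ?thesis
    unfolding A_def power2_norm_eq_inner
    by (simp add: inner_diff_left inner_diff_right inner_commute algebra_simps)
qed

text \<open>Bounding \<open>(norm (H x))^2\<close> by \<open>self_adjoint_norm_le\<close> leaves an
  affine function of \<open>t\<close> on \<open>[m * N, L * N]\<close>. The sign of its slope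
  \<open>1 - \<gamma> * (L + m)\<close> selects the minimising endpoint; the endpoint values are the
  two terms of the \<open>min\<close> times \<open>N\<close>.\<close>

lemma self_adjoint_concave_quadratic_ge:
  fixes H :: "'a::euclidean_space \<Rightarrow> 'a"
  assumes "linear H" "\<And>x y. H x \<bullet> y = x \<bullet> H y"
    and ge: "\<And>x. m * (norm x)\<^sup>2 \<le> H x \<bullet> x" and le: "\<And>x. H x \<bullet> x \<le> L * (norm x)\<^sup>2"
    and "\<gamma> \<ge> 0"
  shows "min ((1 - \<gamma> * m) * m) ((1 - \<gamma> * L) * L) * (norm x)\<^sup>2
    \<le> H x \<bullet> x - \<gamma> * (norm (H x))\<^sup>2"
proof -
  define t where "t = H x \<bullet> x"
  define N where "N = (norm x)\<^sup>2"
  have N: "N \<ge> 0" and t: "m * N \<le> t" "t \<le> L * N"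
    using ge le unfolding t_def N_def by auto
  have "\<gamma> * (norm (H x))\<^sup>2 \<le> \<gamma> * ((L + m) * t - L * m * N)"
    using self_adjoint_norm_le[OF assms(1-4)] \<open>\<gamma> \<ge> 0\<close> unfolding t_def N_def
    by (intro mult_left_mono) auto
  moreover have "min ((1 - \<gamma> * m) * m) ((1 - \<gamma> * L) * L) * N
      \<le> t - \<gamma> * ((L + m) * t - L * m * N)"
  proof (cases "1 - \<gamma> * (L + m) \<ge> 0")
    case True
    have "min ((1 - \<gamma> * m) * m) ((1 - \<gamma> * L) * L) * N \<le> (1 - \<gamma> * m) * m * N"
      using N by (intro mult_right_mono) auto
    moreover have "(1 - \<gamma> * (L + m)) * (m * N) \<le> (1 - \<gamma> * (L + m)) * t"
      using True t by (intro mult_left_mono)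
    ultimately show ?thesis by (simp add: algebra_simps)
  next
    case False
    have "min ((1 - \<gamma> * m) * m) ((1 - \<gamma> * L) * L) * N \<le> (1 - \<gamma> * L) * L * N"
      using N by (intro mult_right_mono) auto
    moreover have "(1 - \<gamma> * (L + m)) * (L * N) \<le> (1 - \<gamma> * (L + m)) * t"
      using False t by (intro mult_left_mono_neg) auto
    ultimately show ?thesis by (simp add: algebra_simps)
  qed
  ultimately show ?thesis unfolding t_def N_def by simp
qed

section \<open>The forward-backward envelope of a quadratic function\<close>

lemma gradient_quadratic:
  fixes H :: "'a::euclidean_space \<Rightarrow> 'a"
  assumes "linear H" and sym: "\<And>x y. H x \<bullet> y = x \<bullet> H y"
  shows "gradient (\<lambda>x. 1 / 2 * (H x \<bullet> x) + h \<bullet> x) y = H y + h"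
proof (rule gradient_eqI)
  have "bounded_linear H" using assms(1) by (simp add: linear_conv_bounded_linear)
  note [derivative_intros] = bounded_linear.has_derivative[OF this]
  show "GDERIV (\<lambda>x. 1 / 2 * (H x \<bullet> x) + h \<bullet> x) y :> H y + h"
    unfolding gderiv_def
    by (rule derivative_eq_intros refl)+
      (use sym[of y] in \<open>auto simp: fun_eq_iff inner_add_right inner_commute\<close>)
qed

text \<open>Outside the conjugate the terms in \<open>h\<close> cancel, so \<open>h\<close> survives
  only as a shift of the conjugate's argument.\<close>

lemma forward_backward_envelope_quadratic:
  fixes H :: "'a::euclidean_space \<Rightarrow> 'a"
  assumes "linear H" "\<And>x y. H x \<bullet> y = x \<bullet> H y"
    and "conjugate_fun (reg_fun \<gamma> g) (x - \<gamma> *\<^sub>R H x - \<gamma> *\<^sub>R h) = ereal r"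
  shows "forward_backward_envelope \<gamma> (\<lambda>x. 1 / 2 * (H x \<bullet> x) + h \<bullet> x) g x
    = ereal (inverse \<gamma> * ((x - \<gamma> *\<^sub>R H x) \<bullet> x / 2 - r))"
proof -
  have "x - \<gamma> *\<^sub>R (H x + h) = x - \<gamma> *\<^sub>R H x - \<gamma> *\<^sub>R h"
    by (simp add: algebra_simps)
  then show ?thesis
    unfolding forward_backward_envelope_def gradient_quadratic[OF assms(1,2)]
    using assms(3)
    by (simp add: inner_diff_left inner_diff_right inner_add_left power2_norm_eq_inner field_simps)
qed

theorem proposition4p4:
  fixes H :: "'a::euclidean_space \<Rightarrow> 'a"
    and h :: 'a
    and f :: "'a \<Rightarrow> real"
    and g :: "'a \<Rightarrow> ereal"
    and L m \<gamma> :: real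
  assumes "linear H" and "adjoint H = H"
    and "f = (\<lambda>x. 1 / 2 * (H x \<bullet> x) + h \<bullet> x)"
    and "proper_fun g" and "closed_fun g" and "convex_fun g"
    and "L = lambda_max H"
    and "\<gamma> \<in> (if L = 0 then {0<..} else {0<..<1 / L})"
    and "m = lambda_min H" and "m \<ge> 0"
  shows "(\<forall>x. \<bar>forward_backward_envelope \<gamma> f g x\<bar> \<noteq> \<infinity>) \<and>
    smooth_fun (inverse \<gamma> * (1 - \<gamma> * m))
      (\<lambda>x. real_of_ereal (forward_backward_envelope \<gamma> f g x)) \<and>
    strongly_convex (min ((1 - \<gamma> * m) * m) ((1 - \<gamma> * L) * L))
      (\<lambda>x. real_of_ereal (forward_backward_envelope \<gamma> f g x))"
proof -
  have sym: "H x \<bullet> y = x \<bullet> H y" for x y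
    using adjoint_works[OF assms(1), of x y] assms(2) by simp
  have le: "H x \<bullet> x \<le> L * (norm x)\<^sup>2" and ge: "m * (norm x)\<^sup>2 \<le> H x \<bullet> x" for x
    using self_adjoint_le_lambda_max[OF assms(1) sym] self_adjoint_ge_lambda_min[OF assms(1) sym]
      assms(7,9) by auto
  \<comment> \<open>Evaluating both Rayleigh bounds at a unit vector compares \<open>m\<close> with
    \<open>L\<close>.\<close>
  obtain b :: 'a where "norm b = 1" by (metis vector_choose_size zero_le_one)
  then have mL: "m \<le> L" using le[of b] ge[of b] by simp
  have \<gamma>: "\<gamma> > 0" "\<gamma> * L < 1"
    using assms(8,10) mL by (auto split: if_splits simp: field_simps)
  have \<gamma>m: "\<gamma> * m \<le> 1"
    using mult_left_mono[OF mL, of \<gamma>] \<gamma> by linarith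
  obtain R P where R: "\<And>v. conjugate_fun (reg_fun \<gamma> g) v = ereal (R v)"
    and R_ge: "\<And>u v. 0 \<le> R u - R v - P v \<bullet> (u - v)"
    and R_le: "\<And>u v. R u - R v - P v \<bullet> (u - v) \<le> (norm (u - v))\<^sup>2 / 2"
    using conjugate_reg_fun_smooth[OF assms(4-6) \<gamma>(1)] by blast
  define Q where "Q x = x - \<gamma> *\<^sub>R H x" for x
  define F where "F x = inverse \<gamma> * (Q x \<bullet> x / 2 - R (Q x - \<gamma> *\<^sub>R h))" for x
  \<comment> \<open>This is the gradient of \<open>F\<close> by the chain rule, with
    \<open>Q\<close> self-adjoint and \<open>P\<close> the gradient of \<open>R\<close>.\<close>
  define G where "G y = inverse \<gamma> *\<^sub>R (Q y - Q (P (Q y - \<gamma> *\<^sub>R h)))" for y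
  define \<sigma> where "\<sigma> = min ((1 - \<gamma> * m) * m) ((1 - \<gamma> * L) * L)"
  \<comment> \<open>This settles finiteness, so \<open>real_of_ereal\<close> returns the true value
    \<open>F x\<close>.\<close>
  have FBE: "forward_backward_envelope \<gamma> f g x = ereal (F x)" for x
    unfolding assms(3) F_def Q_def
    by (rule forward_backward_envelope_quadratic[OF assms(1) sym R])
  have Q_sym: "Q x \<bullet> y = x \<bullet> Q y" for x y
    by (simp add: Q_def inner_diff_left inner_diff_right sym)
  have Q_diff: "Q (x - y) = Q x - Q y" for x y
    by (simp add: Q_def linear_diff[OF assms(1)] algebra_simps)
  define E where "E x y = R (Q x - \<gamma> *\<^sub>R h) - R (Q y - \<gamma> *\<^sub>R h)
      - P (Q y - \<gamma> *\<^sub>R h) \<bullet> Q (x - y)" for x y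
  have E: "0 \<le> E x y" "E x y \<le> (norm (Q (x - y)))\<^sup>2 / 2" for x y
    using R_ge[of "Q x - \<gamma> *\<^sub>R h" "Q y - \<gamma> *\<^sub>R h"] R_le[of "Q x - \<gamma> *\<^sub>R h" "Q y - \<gamma> *\<^sub>R h"]
    by (simp_all add: E_def Q_diff)
  have error: "F x - F y - G y \<bullet> (x - y) = inverse \<gamma> * (Q (x - y) \<bullet> (x - y) / 2 - E x y)" for x y
  proof -
    have Q: "Q x \<bullet> x / 2 - Q y \<bullet> y / 2 = Q y \<bullet> (x - y) + Q (x - y) \<bullet> (x - y) / 2"
      using Q_sym[of y x]
      by (simp add: Q_diff inner_diff_left inner_diff_right inner_commute field_simps)
    have G: "G y \<bullet> (x - y)
        = inverse \<gamma> * (Q y \<bullet> (x - y) - P (Q y - \<gamma> *\<^sub>R h) \<bullet> Q (x - y))"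
      by (simp add: G_def inner_diff_left Q_sym[of "P (Q y - \<gamma> *\<^sub>R h)"])
    have "F x - F y = inverse \<gamma> * ((Q x \<bullet> x / 2 - Q y \<bullet> y / 2)
        - (R (Q x - \<gamma> *\<^sub>R h) - R (Q y - \<gamma> *\<^sub>R h)))"
      unfolding F_def by (simp only: right_diff_distrib)
    then show ?thesis
      unfolding Q G E_def by (simp only: right_diff_distrib distrib_left)
  qed
  have Q_le: "Q d \<bullet> d \<le> (1 - \<gamma> * m) * (norm d)\<^sup>2" for d
    using mult_left_mono[OF ge[of d], of \<gamma>] \<gamma>(1)
    by (simp add: Q_def inner_diff_left power2_norm_eq_inner algebra_simps)
  have upper: "F x - F y - G y \<bullet> (x - y) \<le> inverse \<gamma> * (1 - \<gamma> * m) / 2 * (norm (x - y))\<^sup>2" for x y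
  proof -
    have "inverse \<gamma> * (Q (x - y) \<bullet> (x - y) / 2 - E x y)
        \<le> inverse \<gamma> * ((1 - \<gamma> * m) * (norm (x - y))\<^sup>2 / 2)"
      using Q_le[of "x - y"] E(1)[of x y] \<gamma>(1) by (intro mult_left_mono) auto
    then show ?thesis unfolding error by simp
  qed
  have lower: "\<sigma> / 2 * (norm (x - y))\<^sup>2 \<le> F x - F y - G y \<bullet> (x - y)" for x y
  proof -
    define d where "d = x - y"
    have "\<sigma> * (norm d)\<^sup>2 \<le> H d \<bullet> d - \<gamma> * (norm (H d))\<^sup>2"
      unfolding \<sigma>_def using \<gamma>(1)
      by (intro self_adjoint_concave_quadratic_ge[OF assms(1) sym ge le]) auto
    \<comment> \<open>Since \<open>d - Q d = \<gamma> *\<^sub>R H d\<close>, the bracket equals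
      \<open>\<gamma> * (Q d \<bullet> H d)\<close>.\<close>
    also have "\<dots> = inverse \<gamma> * (Q d \<bullet> d - (norm (Q d))\<^sup>2)"
      using \<gamma>(1) unfolding Q_def power2_norm_eq_inner
      by (simp add: inner_diff_left inner_diff_right inner_commute field_simps)
    also have "\<dots> \<le> inverse \<gamma> * (Q d \<bullet> d - 2 * E x y)"
      using E(2)[of x y] \<gamma>(1) unfolding d_def by (intro mult_left_mono) auto
    finally show ?thesis unfolding error d_def by (simp add: algebra_simps)
  qed
  \<comment> \<open>With this sign the strong convexity bound makes the error nonnegative, which
    covers the lower half of smoothness.\<close>
  have "\<sigma> \<ge> 0"
    using \<gamma>(2) \<gamma>m mL assms(10) unfolding \<sigma>_def
    by (intro min.boundedI mult_nonneg_nonneg) linarith+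
  have "smooth_fun (inverse \<gamma> * (1 - \<gamma> * m)) F"
  proof (rule smooth_funI)
    show "0 \<le> inverse \<gamma> * (1 - \<gamma> * m)" using \<gamma> \<gamma>m by simp
    fix x y :: 'a
    have "0 \<le> \<sigma> / 2 * (norm (x - y))\<^sup>2" using \<open>\<sigma> \<ge> 0\<close> by simp
    then show "\<bar>F x - F y - G y \<bullet> (x - y)\<bar> \<le> inverse \<gamma> * (1 - \<gamma> * m) / 2 * (norm (x - y))\<^sup>2"
      using upper[of x y] lower[of x y] by linarith
  qed
  moreover have "strongly_convex \<sigma> F"
    by (rule strongly_convexI[OF lower])
  ultimately show ?thesis
    unfolding FBE \<sigma>_def by simp
qed

end
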